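(* The series $$\sigma = \sum_{n=1}^{\infty}\frac{(-1)^{n-1}}{n}\left(\sum_{k=1}^{\infty}\frac{(-1)^{k-1}}{n+k}\right)^2 = \sum_{n=1}^{\infty}\frac{(-1)^{n-1}}{n}\left(\ln 2 - \sum_{k=1}^{n}\frac{(-1)^{k-1}}{k}\right)^2$$ converges and its value is $$\sigma = \frac{\pi^2}{12}\ln 2 + \frac{1}{3}(\ln 2)^3 - \frac{1}{2}\zeta(3) \quad (\approx 0.08007).$$
   Context: $\zeta(3)=\sum_{n=1}^\infty \frac{1}{n^3}$ is the value of the Riemann zeta function at $3$. Infinite series are understood as limits of their partial sums. The parenthetical decimal is only a numerical approximation of the exact value. *)

theory Defs
  imports "HOL-Analysis.Analysis"
begin

text \<open>
  Series over the indices 1, 2, 3, ... are written as series over nat via Suc: the summand of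
  index n + 1 stands at position n, so the sign of that summand becomes (-1)^n.
\<close>

definition zeta3 :: real where
  "zeta3 = (\<Sum>n. 1 / real (Suc n) ^ 3)"

lemma zeta3_sums: "(\<lambda>n. 1 / real (Suc n) ^ 3) sums zeta3"
proof -
  have "summable (\<lambda>n. inverse (real n ^ 3))"
    by (rule inverse_power_summable) simp
  then have "summable (\<lambda>n. 1 / real (Suc n) ^ 3)"
    by (subst (asm) summable_Suc_iff [symmetric]) (simp add: inverse_eq_divide)
  then show ?thesis
    unfolding zeta3_def by (rule summable_sums)
qed

text \<open>The alternating tail: the sum over k = 1, 2, ... of (-1)^(k-1) / (n + k).\<close>

definition alt_tail :: "nat \<Rightarrow> real" where
  "alt_tail n = (\<Sum>k. (-1) ^ k / real (n + Suc k))"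

end

theory Submission
  imports Defs
begin

text \<open>
  Write \<open>r(n)\<close> for the remainder of the alternating harmonic series after \<open>n\<close> terms and
  \<open>a(n) = (-1)^(n-1)/n = r(n-1) - r(n)\<close>. The alternating tail is \<open>r(n)\<close> up to sign, so the sum
  in question is \<open>\<sigma> = \<Sum> a(n) r(n)^2\<close>. This is a discrete analogue of integrating the square of
  \<open>r\<close> against \<open>dr\<close>: telescoping the cubes \<open>r(n-1)^3 - r(n)^3 = (r(n) + a(n))^3 - r(n)^3\<close> gives
  \<open>(ln 2)^3 = 3 \<sigma> + 3 \<Sum> r(n)/n^2 + \<Sum> a(n)^3\<close>, and the last sum is \<open>3/4 \<zeta>(3)\<close>.

  What remains is \<open>\<Sum> r(n)/n^2\<close>. It is hidden in the signed Tornheim double sums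
  \<open>T(s,t) = \<Sum> s^n t^k / (n k (n+k))\<close> over positive \<open>n\<close> and \<open>k\<close>, which converge absolutely for
  \<open>|s|, |t| \<le> 1\<close> and can therefore be evaluated in any order. Summing over \<open>k\<close> first, with
  \<open>1/(k(n+k)) = (1/k - 1/(n+k))/n\<close>, shows \<open>T(-1,-1) = \<pi>^2/12 ln 2 + \<Sum> r(n)/n^2\<close>
  (\<open>sums_alt_rem_over_squares\<close>). On the other hand \<open>T(-1,-1) = \<zeta>(3)/4\<close>
  (\<open>tornheim_alternating\<close>), because of two linear relations. Comparing summation by rows with
  summation along the diagonals \<open>n + k = m\<close> gives \<open>T(s,1) = T(s,s)/2 + \<Sum> s^n/n^3\<close>
  (\<open>tornheim_one_right\<close>), as both are sums of harmonic numbers. For \<open>s = 1\<close> it yields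
  \<open>T(1,1) = 2 \<zeta>(3)\<close>, for \<open>s = -1\<close> it relates \<open>T(-1,1)\<close> and \<open>T(-1,-1)\<close>. Selecting the terms
  with \<open>n\<close> and \<open>k\<close> even, by signs and by the substitution \<open>n = 2n', k = 2k'\<close>, gives
  \<open>T(1,1) + 2 T(-1,1) + T(-1,-1) = T(1,1)/2\<close> (\<open>tornheim_even_part\<close>).
\<close>

section \<open>Sums over the positive integers\<close>

abbreviation P :: "nat set" where "P \<equiv> {1..}"

lemma has_sum_pos_imp_sums:
  fixes f :: "nat \<Rightarrow> real"
  assumes "(f has_sum s) P"
  shows "(\<lambda>n. f (Suc n)) sums s"
proof -
  have "bij_betw Suc UNIV P"
    by (rule bij_betwI[where g = "\<lambda>n. n - 1"]) auto
  then have "((\<lambda>n. f (Suc n)) has_sum s) UNIV"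
    using assms has_sum_reindex_bij_betw[of Suc UNIV P f s] by simp
  then show ?thesis by (rule has_sum_imp_sums)
qed

text \<open>
  Rows of the double sums have limits that are only available from ordinary, possibly conditionally
  convergent series; unconditional summability transfers such a limit to \<open>has_sum\<close>.
\<close>

lemma has_sum_pos_if_sums:
  fixes f :: "nat \<Rightarrow> real"
  assumes "f summable_on P" and "(\<lambda>n. f (Suc n)) sums s"
  shows "(f has_sum s) P"
  using has_sum_pos_imp_sums[OF has_sum_infsum[OF assms(1)]] assms
  by (metis has_sum_infsum sums_unique2)

lemma summable_on_dominated:
  fixes f :: "'a \<Rightarrow> real"
  assumes "g summable_on A" and "\<And>x. x \<in> A \<Longrightarrow> \<bar>f x\<bar> \<le> g x"
  shows "f summable_on A"
proof -
  have "(\<lambda>x. \<bar>f x\<bar>) summable_on A"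
    using assms by (rule summable_on_comparison_test) auto
  then show ?thesis
    using summable_on_iff_abs_summable_on_real[of f A] by simp
qed

lemma summable_on_inverse_powr:
  assumes "a > 1"
  shows "(\<lambda>n. real n powr (- a)) summable_on P"
proof -
  have "summable (\<lambda>n. norm (real n powr (- a)))"
    using assms by (simp add: summable_real_powr_iff)
  then have "(\<lambda>n. real n powr (- a)) summable_on UNIV"
    by (rule norm_summable_imp_summable_on)
  then show ?thesis by (rule summable_on_subset_banach) auto
qed

lemma summable_on_inverse_power:
  fixes s :: real
  assumes "p \<ge> 2" "\<bar>s\<bar> \<le> 1"
  shows "(\<lambda>n. s ^ n / real n ^ p) summable_on P"
proof (rule summable_on_dominated)
  show "(\<lambda>n. real n powr (- real p)) summable_on P"
    using summable_on_inverse_powr[of "real p"] assms(1) by simp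
  fix n assume "n \<in> P"
  then have "real n powr (- real p) = 1 / real n ^ p"
    by (simp add: powr_minus powr_realpow inverse_eq_divide)
  moreover have "\<bar>s ^ n\<bar> \<le> 1"
    using assms(2) by (simp add: power_abs power_le_one)
  ultimately show "\<bar>s ^ n / real n ^ p\<bar> \<le> real n powr (- real p)"
    by (simp add: divide_right_mono)
qed

text \<open>
  The signs \<open>(-1)^n\<close> equal twice the indicator of the even numbers minus \<open>1\<close>.
\<close>

lemma has_sum_alternate:
  fixes f :: "nat \<Rightarrow> real"
  assumes "(f has_sum a) P" and "((\<lambda>n. f (2 * n)) has_sum b) P"
  shows "((\<lambda>n. (-1) ^ n * f n) has_sum (2 * b - a)) P"
proof -
  have inj: "inj_on (\<lambda>n::nat. 2 * n) P" by (auto intro: inj_onI)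
  have "(f has_sum b) ((\<lambda>n. 2 * n) ` P)"
    using assms(2) has_sum_reindex[OF inj, of f b] by (simp add: o_def)
  also have "?this \<longleftrightarrow> ((\<lambda>n. if even n then f n else 0) has_sum b) P"
    by (rule has_sum_cong_neutral) (auto simp: image_iff elim!: evenE)
  finally have "((\<lambda>n. 2 * (if even n then f n else 0) + (-1) * f n) has_sum (2 * b + (-1) * a)) P"
    using assms(1) by (intro has_sum_add has_sum_cmult_right)
  also have "(\<lambda>n. 2 * (if even n then f n else 0) + (-1) * f n) = (\<lambda>n. (-1) ^ n * f n)"
    by (auto simp: fun_eq_iff)
  finally show ?thesis by simp
qed

lemma has_sum_alternating_zeta:
  assumes "((\<lambda>n. 1 / real n ^ p) has_sum z) P"
  shows "((\<lambda>n. (-1) ^ n / real n ^ p) has_sum (2 / 2 ^ p - 1) * z) P"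
proof -
  have "((\<lambda>n. (1 / 2 ^ p) * (1 / real n ^ p)) has_sum (1 / 2 ^ p) * z) P"
    by (intro has_sum_cmult_right assms)
  then have "((\<lambda>n. 1 / real (2 * n) ^ p) has_sum (1 / 2 ^ p) * z) P"
    by (simp add: power_mult_distrib)
  from has_sum_alternate[OF assms this] show ?thesis
    by (simp add: algebra_simps)
qed

lemma has_sum_zeta2: "((\<lambda>n. 1 / real n ^ 2) has_sum pi ^ 2 / 6) P"
  by (rule has_sum_pos_if_sums)
     (use summable_on_inverse_power[of 2 1] inverse_squares_sums in \<open>auto simp: add.commute\<close>)

lemma has_sum_zeta3: "((\<lambda>n. 1 / real n ^ 3) has_sum zeta3) P"
  by (rule has_sum_pos_if_sums)
     (use summable_on_inverse_power[of 3 1] zeta3_sums in auto)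

section \<open>Signed Tornheim sums\<close>

definition tornheim_term :: "real \<Rightarrow> real \<Rightarrow> nat \<times> nat \<Rightarrow> real" where
  "tornheim_term s t = (\<lambda>(n, k). s ^ n * t ^ k / (real n * real k * real (n + k)))"

definition tornheim :: "real \<Rightarrow> real \<Rightarrow> real" where
  "tornheim s t = infsum (tornheim_term s t) (P \<times> P)"

text \<open>
  By the inequality of arithmetic and geometric means, \<open>n + k\<close> is at least the geometric mean of
  \<open>n\<close> and \<open>k\<close>, so the terms are dominated by the product \<open>n powr (-3/2) * k powr (-3/2)\<close>.
\<close>

lemma tornheim_term_summable:
  assumes "\<bar>s\<bar> \<le> 1" "\<bar>t\<bar> \<le> 1"
  shows "tornheim_term s t summable_on P \<times> P"
proof -
  define q where "q n = real n powr (- (3/2))" for n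
  have q: "q summable_on P" unfolding q_def by (rule summable_on_inverse_powr) simp
  have "(\<lambda>(n, k). q n * q k) summable_on Sigma P (\<lambda>_. P)"
  proof (rule summable_on_SigmaI)
    show "((\<lambda>k. case (n, k) of (n, k) \<Rightarrow> q n * q k) has_sum q n * infsum q P) P" for n
      using has_sum_cmult_right[OF has_sum_infsum[OF q], of "q n"] by simp
    show "(\<lambda>n. q n * infsum q P) summable_on P"
      by (intro summable_on_cmult_left q)
  qed (auto simp: q_def)
  then show ?thesis
  proof (rule summable_on_dominated, clarsimp simp: tornheim_term_def)
    fix n k :: nat
    assume nk: "n \<ge> Suc 0" "k \<ge> Suc 0"
    have pw: "q m = 1 / (real m * sqrt (real m))" if "m \<ge> Suc 0" for m
    proof -
      have "real m powr (1 + 1/2) = real m * sqrt (real m)"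
        using that by (simp only: powr_add powr_half_sqrt powr_one of_nat_0_le_iff)
      then have "real m powr (3/2) = real m * sqrt (real m)"
        by simp
      then show ?thesis
        unfolding q_def powr_minus by (simp only: inverse_eq_divide)
    qed
    have "sqrt (real n) * sqrt (real k) \<le> real n + real k"
      using arith_geo_mean_sqrt[of "real n" "real k"] by (simp add: real_sqrt_mult)
    then have "1 / (real n + real k) \<le> 1 / (sqrt (real n) * sqrt (real k))"
      using nk by (intro divide_left_mono) auto
    then have le: "1 / (real n * real k) * (1 / (real n + real k))
        \<le> 1 / (real n * real k) * (1 / (sqrt (real n) * sqrt (real k)))"
      by (intro mult_left_mono) auto
    have "\<bar>s ^ n * t ^ k\<bar> \<le> 1"
      using assms by (simp add: abs_mult power_abs mult_le_one power_le_one)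
    then have "\<bar>s ^ n * t ^ k\<bar> * (1 / (real n * real k * (real n + real k)))
        \<le> 1 / (real n * real k * (real n + real k))"
      by (intro mult_left_le_one_le) auto
    also have "\<dots> = 1 / (real n * real k) * (1 / (real n + real k))"
      by simp
    also have "\<dots> \<le> 1 / (real n * real k) * (1 / (sqrt (real n) * sqrt (real k)))"
      by (rule le)
    also have "\<dots> = q n * q k"
      using nk by (simp add: pw mult_ac)
    finally show "\<bar>s ^ n * t ^ k\<bar> / (real n * real k * (real n + real k)) \<le> q n * q k"
      by simp
  qed
qed

lemma has_sum_tornheim:
  assumes "\<bar>s\<bar> \<le> 1" "\<bar>t\<bar> \<le> 1"
  shows "(tornheim_term s t has_sum tornheim s t) (P \<times> P)"
  unfolding tornheim_def by (rule has_sum_infsum[OF tornheim_term_summable[OF assms]])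

text \<open>
  Partial fractions in \<open>k\<close>: \<open>1/(n k (n+k)) = (1/k - 1/(n+k)) / n^2\<close>. The row limits \<open>g\<close> are a
  parameter because they are harmonic numbers for \<open>t = 1\<close> but involve \<open>ln 2\<close> for \<open>t = -1\<close>.
\<close>

lemma has_sum_tornheim_rows:
  assumes "\<bar>s\<bar> \<le> 1" "\<bar>t\<bar> \<le> 1"
    and row: "\<And>n. n \<ge> 1 \<Longrightarrow> (\<lambda>k. t ^ Suc k / real (Suc k) - t ^ Suc k / real (n + Suc k)) sums g n"
  shows "((\<lambda>n. s ^ n / real n ^ 2 * g n) has_sum tornheim s t) P"
proof (rule has_sum_SigmaD)
  show "(tornheim_term s t has_sum tornheim s t) (P \<times> P)"
    by (rule has_sum_tornheim[OF assms(1,2)])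
  fix n assume n: "n \<in> P"
  show "((\<lambda>k. tornheim_term s t (n, k)) has_sum s ^ n / real n ^ 2 * g n) P"
  proof (rule has_sum_pos_if_sums)
    have "tornheim_term s t summable_on Pair n ` P"
      by (rule summable_on_subset_banach[OF tornheim_term_summable[OF assms(1,2)]]) (use n in auto)
    then show "(\<lambda>k. tornheim_term s t (n, k)) summable_on P"
      by (subst (asm) summable_on_reindex) (auto simp: inj_on_def o_def)
    have "(\<lambda>k. s ^ n / real n ^ 2 * (t ^ Suc k / real (Suc k) - t ^ Suc k / real (n + Suc k)))
        sums (s ^ n / real n ^ 2 * g n)"
      using row n by (intro sums_mult) auto
    moreover have "s ^ n / real n ^ 2 * (t ^ Suc k / real (Suc k) - t ^ Suc k / real (n + Suc k))
        = tornheim_term s t (n, Suc k)" for k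
      using n by (simp add: tornheim_term_def field_simps power2_eq_square del: power_Suc)
    ultimately show "(\<lambda>k. tornheim_term s t (n, Suc k)) sums (s ^ n / real n ^ 2 * g n)"
      by (simp only:)
  qed
qed

lemma tornheim_commute: "tornheim s t = tornheim t s"
  unfolding tornheim_def
  by (rule infsum_reindex_bij_witness[of _ prod.swap prod.swap])
     (auto simp: tornheim_term_def mult.commute add.commute)

lemma harmonic_sums:
  "(\<lambda>k. 1 / real (Suc k) - 1 / real (n + Suc k)) sums (\<Sum>j=1..n. 1 / real j)"
proof (induction n)
  case (Suc n)
  have "(\<lambda>k. 1 / real (n + Suc k)) \<longlonglongrightarrow> 0"
    using LIMSEQ_ignore_initial_segment[OF lim_1_over_n, of "Suc n"] by (simp add: add_ac)
  from telescope_sums'[OF this]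
  have "(\<lambda>k. 1 / real (n + Suc k) - 1 / real (n + Suc (Suc k))) sums (1 / real (Suc n))"
    by simp
  from sums_add[OF Suc.IH this] show ?case by simp
qed simp

text \<open>
  On the diagonal \<open>n + k = m\<close> the numerator is the constant \<open>s^m\<close>, and
  \<open>1/(n k) = (1/n + 1/k)/m\<close>; the two halves agree under \<open>n \<mapsto> m - n\<close>.
\<close>

lemma has_sum_tornheim_diag:
  assumes "\<bar>s\<bar> \<le> 1"
  shows "((\<lambda>m. s ^ m / real m ^ 2 * (2 * (\<Sum>j\<in>{1..<m}. 1 / real j))) has_sum tornheim s s) P"
proof (rule has_sum_SigmaD)
  define h where "h = (\<lambda>(m, n). s ^ m / (real m * (real n * real (m - n))))"
  have "(tornheim_term s s has_sum tornheim s s) (P \<times> P)"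
    by (rule has_sum_tornheim[OF assms assms])
  also have "?this \<longleftrightarrow> (h has_sum tornheim s s) (Sigma P (\<lambda>m. {1..<m}))"
    by (rule has_sum_reindex_bij_witness[of _ "\<lambda>(m, n). (n, m - n)" "\<lambda>(n, k). (n + k, n)"])
       (auto simp: h_def tornheim_term_def power_add mult_ac)
  finally show "(h has_sum tornheim s s) (Sigma P (\<lambda>m. {1..<m}))" .
  fix m assume m: "m \<in> P"
  have "(\<Sum>n\<in>{1..<m}. h (m, n))
      = (\<Sum>n\<in>{1..<m}. s ^ m / real m ^ 2 * (1 / real n + 1 / real (m - n)))"
  proof (rule sum.cong)
    fix n assume "n \<in> {1..<m}"
    then have m_eq: "real m = real n + real (m - n)" and pos: "real n > 0" "real (m - n) > 0"
      by auto
    have partial_fractions: "c / ((x + y) * (x * y)) = c / (x + y) ^ 2 * (1 / x + 1 / y)"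
      if "x > 0" "y > 0" for c x y :: real
    proof -
      have "1 / x + 1 / y = (x + y) / (x * y)" "x + y \<noteq> 0"
        using that by (auto simp: add_divide_distrib)
      then show ?thesis by (simp add: power2_eq_square)
    qed
    show "h (m, n) = s ^ m / real m ^ 2 * (1 / real n + 1 / real (m - n))"
      unfolding h_def prod.case m_eq by (rule partial_fractions[OF pos])
  qed simp
  also have "\<dots> = s ^ m / real m ^ 2 * ((\<Sum>n\<in>{1..<m}. 1 / real n) + (\<Sum>n\<in>{1..<m}. 1 / real (m - n)))"
    by (simp only: sum.distrib sum_distrib_left [symmetric])
  also have "(\<Sum>n\<in>{1..<m}. 1 / real (m - n)) = (\<Sum>n\<in>{1..<m}. 1 / real n)"
    by (rule sum.reindex_bij_witness[of _ "\<lambda>n. m - n" "\<lambda>n. m - n"]) auto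
  finally have "(\<Sum>n\<in>{1..<m}. h (m, n)) = s ^ m / real m ^ 2 * (2 * (\<Sum>j\<in>{1..<m}. 1 / real j))"
    by simp
  then show "((\<lambda>n. h (m, n)) has_sum s ^ m / real m ^ 2 * (2 * (\<Sum>j\<in>{1..<m}. 1 / real j))) {1..<m}"
    by (intro has_sum_finiteI) auto
qed

text \<open>
  The rows of \<open>T(s,1)\<close> sum to \<open>s^m/m^2\<close> times the harmonic number of \<open>m\<close>, the diagonals of
  \<open>T(s,s)\<close> to \<open>2 s^m/m^2\<close> times that of \<open>m - 1\<close>; the difference \<open>1/m\<close> produces the cubes.
\<close>

lemma tornheim_one_right:
  assumes "\<bar>s\<bar> \<le> 1" and z: "((\<lambda>n. s ^ n / real n ^ 3) has_sum z) P"
  shows "tornheim s 1 = tornheim s s / 2 + z"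
proof -
  have "((\<lambda>m. 1 / 2 * (s ^ m / real m ^ 2 * (2 * (\<Sum>j\<in>{1..<m}. 1 / real j))) + s ^ m / real m ^ 3)
      has_sum (1 / 2 * tornheim s s + z)) P"
    by (intro has_sum_add has_sum_cmult_right has_sum_tornheim_diag assms)
  moreover have "1 / 2 * (s ^ m / real m ^ 2 * (2 * (\<Sum>j\<in>{1..<m}. 1 / real j))) + s ^ m / real m ^ 3
      = s ^ m / real m ^ 2 * (\<Sum>j=1..m. 1 / real j)" if m: "m \<in> P" for m
  proof -
    have "{1..m} = insert m {1..<m}" using m by auto
    then have "(\<Sum>j=1..m. 1 / real j) = 1 / real m + (\<Sum>j\<in>{1..<m}. 1 / real j)" by simp
    then show ?thesis by (simp add: algebra_simps power2_eq_square power3_eq_cube)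
  qed
  ultimately have "((\<lambda>m. s ^ m / real m ^ 2 * (\<Sum>j=1..m. 1 / real j)) has_sum (1 / 2 * tornheim s s + z)) P"
    using has_sum_cong[of P] by (metis (no_types, lifting))
  moreover have "((\<lambda>m. s ^ m / real m ^ 2 * (\<Sum>j=1..m. 1 / real j)) has_sum tornheim s 1) P"
    using assms(1) harmonic_sums by (intro has_sum_tornheim_rows) auto
  ultimately show ?thesis
    by (auto dest: has_sum_unique)
qed

text \<open>
  The four choices of signs add up to \<open>(1 + (-1)^n) (1 + (-1)^k)\<close>, which is \<open>4\<close> if both indices are
  even and \<open>0\<close> otherwise; halving the indices of the surviving terms multiplies them by \<open>8\<close>.
\<close>

lemma tornheim_even_part:
  "tornheim 1 1 + 2 * tornheim (-1) 1 + tornheim (-1) (-1) = tornheim 1 1 / 2"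
proof -
  let ?d = "\<lambda>(n, k). (2 * n, 2 * k)"
  let ?e = "\<lambda>(n, k). if even n \<and> even k then 4 * tornheim_term 1 1 (n, k) else 0"
  have inj: "inj_on ?d (P \<times> P)" by (auto intro!: inj_onI)
  have "((\<lambda>x. 1 / 2 * tornheim_term 1 1 x) has_sum (1 / 2 * tornheim 1 1)) (P \<times> P)"
    by (intro has_sum_cmult_right has_sum_tornheim) auto
  also have "(\<lambda>x. 1 / 2 * tornheim_term 1 1 x) = ?e \<circ> ?d"
  proof (rule ext, clarify)
    fix n k
    have "real (2 * n) * real (2 * k) * real (2 * n + 2 * k) = 8 * (real n * real k * real (n + k))"
      by (simp add: algebra_simps)
    then have "tornheim_term 1 1 (n, k) = 8 * tornheim_term 1 1 (2 * n, 2 * k)"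
      by (simp only: tornheim_term_def prod.case power_one) simp
    then show "1 / 2 * tornheim_term 1 1 (n, k) = (?e \<circ> ?d) (n, k)"
      by simp
  qed
  also have "((?e \<circ> ?d) has_sum (1 / 2 * tornheim 1 1)) (P \<times> P)
      \<longleftrightarrow> (?e has_sum (1 / 2 * tornheim 1 1)) (?d ` (P \<times> P))"
    by (rule has_sum_reindex[OF inj, symmetric])
  also have "\<dots> \<longleftrightarrow> (?e has_sum (1 / 2 * tornheim 1 1)) (P \<times> P)"
  proof (rule has_sum_cong_neutral)
    fix x assume x: "x \<in> P \<times> P - ?d ` (P \<times> P)"
    obtain n k where nk: "x = (n, k)" by (cases x)
    have "\<not> (even n \<and> even k)"
    proof
      assume "even n \<and> even k"
      then have "x = ?d (n div 2, k div 2)" and "(n div 2, k div 2) \<in> P \<times> P"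
        using x nk by (auto elim!: evenE)
      then show False using x by blast
    qed
    then show "?e x = 0" by (auto simp: nk)
  qed auto
  finally have even: "(?e has_sum (1 / 2 * tornheim 1 1)) (P \<times> P)" .
  have "((\<lambda>x. tornheim_term 1 1 x + (tornheim_term (-1) 1 x + tornheim_term 1 (-1) x) + tornheim_term (-1) (-1) x)
      has_sum (tornheim 1 1 + (tornheim (-1) 1 + tornheim 1 (-1)) + tornheim (-1) (-1))) (P \<times> P)"
    by (intro has_sum_add has_sum_tornheim) auto
  also have "(\<lambda>x. tornheim_term 1 1 x + (tornheim_term (-1) 1 x + tornheim_term 1 (-1) x) + tornheim_term (-1) (-1) x) = ?e"
    by (auto simp: fun_eq_iff tornheim_term_def minus_one_power_iff)
  finally show ?thesis
    using even tornheim_commute[of 1 "-1"] by (auto dest: has_sum_unique)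
qed

lemma tornheim_alternating: "tornheim (-1) (-1) = zeta3 / 4"
proof -
  have "tornheim 1 1 = 2 * zeta3"
    using tornheim_one_right[of 1 zeta3] has_sum_zeta3 by simp
  moreover have "tornheim (-1) 1 = tornheim (-1) (-1) / 2 + (2 / 2 ^ 3 - 1) * zeta3"
    by (rule tornheim_one_right[OF _ has_sum_alternating_zeta[OF has_sum_zeta3]]) simp
  ultimately show ?thesis using tornheim_even_part by simp
qed

section \<open>Remainders of the alternating harmonic series\<close>

definition alt_rem :: "nat \<Rightarrow> real" where
  "alt_rem n = ln 2 - (\<Sum>k=1..n. (-1) ^ (k - 1) / real k)"

lemma alt_rem_0: "alt_rem 0 = ln 2" by (simp add: alt_rem_def)

lemma alt_rem_Suc: "alt_rem (Suc n) = alt_rem n - (-1) ^ n / real (Suc n)"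
  by (simp add: alt_rem_def)

lemma sums_alt_rem: "(\<lambda>k. (-1) ^ k / real (n + Suc k)) sums ((-1) ^ n * alt_rem n)"
proof -
  have "(\<lambda>k. (-1) ^ (k + n) / real (Suc (k + n))) sums (ln 2 - (\<Sum>k<n. (-1) ^ k / real (Suc k)))"
    by (rule sums_split_initial_segment[OF alternating_harmonic_series_sums])
  also have "(\<Sum>k<n. (-1) ^ k / real (Suc k)) = (\<Sum>k=1..n. (-1) ^ (k - 1) / real k)"
    by (rule sum.reindex_bij_witness[of _ "\<lambda>k. k - 1" Suc]) auto
  finally have "(\<lambda>k. (-1) ^ n * ((-1) ^ (k + n) / real (Suc (k + n)))) sums ((-1) ^ n * alt_rem n)"
    unfolding alt_rem_def by (rule sums_mult)
  then show ?thesis by (simp add: power_add add_ac mult_ac)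
qed

lemma alt_tail_eq_alt_rem: "alt_tail n = (-1) ^ n * alt_rem n"
  unfolding alt_tail_def using sums_alt_rem by (rule sums_unique[symmetric])

lemma alt_rem_tendsto_0: "alt_rem \<longlonglongrightarrow> 0"
proof -
  have partial: "alt_rem n = ln 2 - (\<Sum>k<n. (-1) ^ k / real (Suc k))" for n
    by (induction n) (simp_all add: alt_rem_0 alt_rem_Suc)
  have "(\<lambda>n. ln 2 - (\<Sum>k<n. (-1) ^ k / real (Suc k))) \<longlonglongrightarrow> ln 2 - ln 2"
    using alternating_harmonic_series_sums unfolding sums_def by (intro tendsto_diff tendsto_const)
  then show ?thesis by (simp add: partial[abs_def])
qed

text \<open>
  The row limits of \<open>T(-1,-1)\<close> are \<open>- ln 2\<close> plus the alternating tail. The part with \<open>ln 2\<close>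
  contributes the alternating form of \<open>\<zeta>(2)\<close>, and the sign of the tail cancels that of the row.
\<close>

lemma sums_alt_rem_over_squares:
  "(\<lambda>n. alt_rem (Suc n) / real (Suc n) ^ 2) sums (zeta3 / 4 - pi ^ 2 / 12 * ln 2)"
proof -
  have "(\<lambda>k. (-1) ^ Suc k / real (Suc k) - (-1) ^ Suc k / real (n + Suc k))
      sums (- ln 2 + (-1) ^ n * alt_rem n)" for n
    using sums_add[OF sums_minus[OF alternating_harmonic_series_sums] sums_alt_rem[of n]]
    by (simp add: field_simps)
  then have "((\<lambda>n. (-1) ^ n / real n ^ 2 * (- ln 2 + (-1) ^ n * alt_rem n)) has_sum zeta3 / 4) P"
    using has_sum_tornheim_rows[of "-1" "-1" "\<lambda>n. - ln 2 + (-1) ^ n * alt_rem n"]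
    by (simp add: tornheim_alternating)
  moreover have "((\<lambda>n. (-1) ^ n / real n ^ 2 * ln 2) has_sum (2 / 2 ^ 2 - 1) * (pi ^ 2 / 6) * ln 2) P"
    by (intro has_sum_cmult_left has_sum_alternating_zeta has_sum_zeta2)
  ultimately have "((\<lambda>n. (-1) ^ n / real n ^ 2 * (- ln 2 + (-1) ^ n * alt_rem n) + (-1) ^ n / real n ^ 2 * ln 2)
      has_sum (zeta3 / 4 + (2 / 2 ^ 2 - 1) * (pi ^ 2 / 6) * ln 2)) P"
    by (rule has_sum_add)
  also have "(\<lambda>n. (-1) ^ n / real n ^ 2 * (- ln 2 + (-1) ^ n * alt_rem n) + (-1) ^ n / real n ^ 2 * ln 2)
      = (\<lambda>n. alt_rem n / real n ^ 2)"
    by (auto simp: fun_eq_iff minus_one_power_iff add_divide_distrib diff_divide_distrib)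
  finally have "((\<lambda>n. alt_rem n / real n ^ 2)
      has_sum (zeta3 / 4 + (2 / 2 ^ 2 - 1) * (pi ^ 2 / 6) * ln 2)) P" .
  from has_sum_pos_imp_sums[OF this] show ?thesis by simp
qed

lemma sums_alternating_zeta3: "(\<lambda>n. (-1) ^ n / real (Suc n) ^ 3) sums (3 / 4 * zeta3)"
  using sums_minus[OF has_sum_pos_imp_sums[OF has_sum_alternating_zeta[OF has_sum_zeta3]]] by simp

text \<open>
  With \<open>r\<close> and \<open>a\<close> as in the introduction,
  \<open>a r^2 = ((r + a)^3 - r^3)/3 - r a^2 - a^3/3\<close>, where \<open>(r + a)^3 - r^3\<close> telescopes.
\<close>

lemma sums_alt_rem_squared:
  "(\<lambda>n. (-1) ^ n / real (Suc n) * alt_rem (Suc n) ^ 2)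
     sums (pi ^ 2 / 12 * ln 2 + 1 / 3 * (ln 2) ^ 3 - 1 / 2 * zeta3)"
proof -
  have "(\<lambda>n. alt_rem n ^ 3) \<longlonglongrightarrow> 0"
    using tendsto_power[OF alt_rem_tendsto_0, of 3] by simp
  from telescope_sums'[OF this]
  have "(\<lambda>n. alt_rem n ^ 3 - alt_rem (Suc n) ^ 3) sums (ln 2) ^ 3"
    by (simp add: alt_rem_0)
  from sums_diff[OF sums_diff[OF sums_mult[OF this, of "1/3"] sums_alt_rem_over_squares]
      sums_mult[OF sums_alternating_zeta3, of "1/3"]]
  have "(\<lambda>n. 1 / 3 * (alt_rem n ^ 3 - alt_rem (Suc n) ^ 3) - alt_rem (Suc n) / real (Suc n) ^ 2
        - 1 / 3 * ((-1) ^ n / real (Suc n) ^ 3))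
      sums (pi ^ 2 / 12 * ln 2 + 1 / 3 * (ln 2) ^ 3 - 1 / 2 * zeta3)"
    by (simp add: algebra_simps)
  moreover have "1 / 3 * (alt_rem n ^ 3 - alt_rem (Suc n) ^ 3) - alt_rem (Suc n) / real (Suc n) ^ 2
        - 1 / 3 * ((-1) ^ n / real (Suc n) ^ 3)
      = (-1) ^ n / real (Suc n) * alt_rem (Suc n) ^ 2" for n
  proof -
    define a where "a = (-1) ^ n / real (Suc n)"
    have a2: "1 / real (Suc n) ^ 2 = a ^ 2" and a3: "(-1) ^ n / real (Suc n) ^ 3 = a ^ 3"
      by (auto simp: a_def power_divide minus_one_power_iff)
    have "alt_rem n = alt_rem (Suc n) + a"
      unfolding a_def alt_rem_Suc by simp
    moreover have "alt_rem (Suc n) / real (Suc n) ^ 2 = alt_rem (Suc n) * a ^ 2"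
      using a2 by (metis times_divide_eq_right mult.right_neutral)
    ultimately show ?thesis unfolding a3 a_def[symmetric]
      by (simp only:) (simp add: power2_eq_square power3_eq_cube algebra_simps)
  qed
  ultimately show ?thesis by simp
qed

theorem mainTheorem1:
  "(\<forall>n\<ge>1. summable (\<lambda>k. (-1) ^ k / real (n + Suc k))) \<and>
   (\<lambda>n. (-1) ^ n / real (Suc n) * (alt_tail (Suc n)) ^ 2)
     sums (pi ^ 2 / 12 * ln 2 + 1 / 3 * (ln 2) ^ 3 - 1 / 2 * zeta3) \<and>
   (\<lambda>n. (-1) ^ n / real (Suc n) *
          (ln 2 - (\<Sum>k=1..Suc n. (-1) ^ (k - 1) / real k)) ^ 2)
     sums (pi ^ 2 / 12 * ln 2 + 1 / 3 * (ln 2) ^ 3 - 1 / 2 * zeta3)"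
proof (intro conjI allI impI)
  show "summable (\<lambda>k. (-1) ^ k / real (n + Suc k))" for n
    using sums_alt_rem by (rule sums_summable)
  have "alt_tail n ^ 2 = alt_rem n ^ 2" for n
    by (simp add: alt_tail_eq_alt_rem power_mult_distrib flip: power_mult)
  then show "(\<lambda>n. (-1) ^ n / real (Suc n) * (alt_tail (Suc n)) ^ 2)
     sums (pi ^ 2 / 12 * ln 2 + 1 / 3 * (ln 2) ^ 3 - 1 / 2 * zeta3)"
    using sums_alt_rem_squared by simp
  show "(\<lambda>n. (-1) ^ n / real (Suc n) *
          (ln 2 - (\<Sum>k=1..Suc n. (-1) ^ (k - 1) / real k)) ^ 2)
     sums (pi ^ 2 / 12 * ln 2 + 1 / 3 * (ln 2) ^ 3 - 1 / 2 * zeta3)"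
    using sums_alt_rem_squared unfolding alt_rem_def .
qed

end
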